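(* For every integer $n\ge1$ and every integer $r$ with $0\le r\le n$, there is a full-column-rank matrix $C\in\mathbb R^{n\times r}$ such that $$\operatorname{sd}(\mathcal T(C))=\operatorname{MSD}(\mathcal T(C))=\min\{n-r,\,r\}.$$
   Context: $\mathbb S^p$ is the space of real symmetric $p\times p$ matrices with inner product $\langle X,Y\rangle=\operatorname{tr}(XY)$, and $\mathbb S^p_+$ is the positive semidefinite cone. Matrices in $\mathbb S^{q+1}$ have rows and columns indexed by $0,1,\dots,q$. For $h\in\mathbb R^q$ ($q\ge0$) let $$\Phi(h)=\begin{pmatrix}0&-\frac12h^T\\-\frac12h&hh^T\end{pmatrix}\in\mathbb S^{q+1}.$$ For $H\in\mathbb R^{n\times q}$ with rows $h_1^T,\dots,h_n^T$ let $$\mathcal T(H)=\{Z\in\mathbb S^{q+1}_+: Z_{00}=1,\ \langle\Phi(h_i),Z\rangle=0,\ i=1,\dots,n\}.$$ In particular $\mathcal T(H)=\{1\}\subset\mathbb S^1_+$ when $q=0$. Singularity degrees: for a set $S$, $S^\perp=\{z:\langle z,s\rangle=0\ \forall s\in S\}$; for a cone $K$, $K^*=\{z:\langle z,x\rangle\ge0\ \forall x\in K\}$. Let $L\subseteq\mathbb S^p$ be an affine subspace with $L\cap\mathbb S^p_+\ne\emptyset$ and let $F_{\min}$ be the minimal face of $\mathbb S^p_+$ containing $L\cap\mathbb S^p_+$. A facial-reduction sequence of length $d\ge0$ consists of faces $F_0=\mathbb S^p_+,F_1,\dots,F_d$ and matrices $W_j\in L^\perp\cap(F_{j-1}^*\setminus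 F_{j-1}^\perp)$ with $F_j=F_{j-1}\cap W_j^\perp$ ($j=1,\dots,d$), and $F_d=F_{\min}$. The singularity degree $\operatorname{sd}(L\cap\mathbb S^p_+)$ (resp. maximum singularity degree $\operatorname{MSD}(L\cap\mathbb S^p_+)$) is the minimum (resp. maximum) length of a facial-reduction sequence; for $\mathcal T(H)$ they are taken with respect to the affine subspace $L$ defined by its equality constraints. *)

theory Defs
  imports "Jordan_Normal_Form.DL_Rank"
begin

definition sym_mats :: "nat \<Rightarrow> real mat set" where
  "sym_mats p = {X \<in> carrier_mat p p. transpose_mat X = X}"

definition psd_mats :: "nat \<Rightarrow> real mat set" where
  "psd_mats p = {X \<in> sym_mats p. \<forall>v \<in> carrier_vec p. 0 \<le> v \<bullet> (X *\<^sub>v v)}"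

definition mat_trace :: "real mat \<Rightarrow> real" where
  "mat_trace X = (\<Sum>i<dim_row X. X $$ (i, i))"

definition mat_inner :: "real mat \<Rightarrow> real mat \<Rightarrow> real" where
  "mat_inner X Y = mat_trace (X * Y)"

text \<open>Orthogonal complements and dual cones are taken inside the space of symmetric
  \<open>p \<times> p\<close> matrices. As in the source, the complement of an affine subspace \<open>L\<close> consists
  of the matrices orthogonal to the points of \<open>L\<close> itself, not merely to its directions.\<close>

definition perp :: "nat \<Rightarrow> real mat set \<Rightarrow> real mat set" where
  "perp p S = {Z \<in> sym_mats p. \<forall>X\<in>S. mat_inner Z X = 0}"

definition dual_cone :: "nat \<Rightarrow> real mat set \<Rightarrow> real mat set" where
  "dual_cone p K = {Z \<in> sym_mats p. \<forall>X\<in>K. 0 \<le> mat_inner Z X}"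

definition mat_convex :: "real mat set \<Rightarrow> bool" where
  "mat_convex S \<longleftrightarrow>
     (\<forall>X\<in>S. \<forall>Y\<in>S. \<forall>t::real. 0 \<le> t \<and> t \<le> 1 \<longrightarrow> t \<cdot>\<^sub>m X + (1 - t) \<cdot>\<^sub>m Y \<in> S)"

text \<open>Faces in the sense of \<open>face_of\<close> from HOL-Analysis, which is not applicable because
  matrices of varying dimension share one type that is not a vector space.\<close>

definition is_face :: "real mat set \<Rightarrow> real mat set \<Rightarrow> bool" where
  "is_face F K \<longleftrightarrow> F \<subseteq> K \<and> mat_convex F \<and>
     (\<forall>X\<in>K. \<forall>Y\<in>K. \<forall>t::real. 0 < t \<and> t < 1 \<and> t \<cdot>\<^sub>m X + (1 - t) \<cdot>\<^sub>m Y \<in> F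
        \<longrightarrow> X \<in> F \<and> Y \<in> F)"

definition min_face :: "nat \<Rightarrow> real mat set \<Rightarrow> real mat set" where
  "min_face p S = \<Inter>{F. is_face F (psd_mats p) \<and> S \<subseteq> F}"

definition facial_reduction_seq ::
    "nat \<Rightarrow> real mat set \<Rightarrow> nat \<Rightarrow> (nat \<Rightarrow> real mat set) \<Rightarrow> (nat \<Rightarrow> real mat) \<Rightarrow> bool" where
  "facial_reduction_seq p L d F W \<longleftrightarrow>
     F 0 = psd_mats p \<and>
     (\<forall>j\<le>d. is_face (F j) (psd_mats p)) \<and>
     (\<forall>j\<in>{1..d}. W j \<in> perp p L \<inter> (dual_cone p (F (j - 1)) - perp p (F (j - 1))) \<and>
                  F j = F (j - 1) \<inter> perp p {W j}) \<and>
     F d = min_face p (L \<inter> psd_mats p)"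

text \<open>Both are meant for affine \<open>L\<close> meeting the positive semidefinite cone. Then a
  facial reduction sequence exists, and lengths are bounded since every step strictly shrinks
  the face, so the minimum and the maximum are attained.\<close>

definition sing_deg :: "nat \<Rightarrow> real mat set \<Rightarrow> nat" where
  "sing_deg p L = (LEAST d. \<exists>F W. facial_reduction_seq p L d F W)"

definition max_sing_deg :: "nat \<Rightarrow> real mat set \<Rightarrow> nat" where
  "max_sing_deg p L = (GREATEST d. \<exists>F W. facial_reduction_seq p L d F W)"

definition Phi :: "real vec \<Rightarrow> real mat" where
  "Phi h = mat (dim_vec h + 1) (dim_vec h + 1) (\<lambda>(i, j).
     if i = 0 \<and> j = 0 then 0
     else if i = 0 then - (1/2) * h $ (j - 1)
     else if j = 0 then - (1/2) * h $ (i - 1)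
     else h $ (i - 1) * h $ (j - 1))"

definition T_set :: "real mat \<Rightarrow> real mat set" where
  "T_set H = {Z \<in> psd_mats (dim_col H + 1).
     Z $$ (0, 0) = 1 \<and> (\<forall>i<dim_row H. mat_inner (Phi (row H i)) Z = 0)}"

text \<open>The affine subspace with respect to which the singularity degrees of \<open>T_set H\<close>
  are taken.\<close>

definition T_affine :: "real mat \<Rightarrow> real mat set" where
  "T_affine H = {Z \<in> sym_mats (dim_col H + 1).
     Z $$ (0, 0) = 1 \<and> (\<forall>i<dim_row H. mat_inner (Phi (row H i)) Z = 0)}"

lemma T_set_eq: "T_set H = T_affine H \<inter> psd_mats (dim_col H + 1)"
  by (auto simp: T_set_def T_affine_def psd_mats_def)

definition sd_T :: "real mat \<Rightarrow> nat" where
  "sd_T H = sing_deg (dim_col H + 1) (T_affine H)"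

definition MSD_T :: "real mat \<Rightarrow> nat" where
  "MSD_T H = max_sing_deg (dim_col H + 1) (T_affine H)"

end

theory Submission
  imports Defs
begin

text \<open>Put \<open>k = min (n - r) r\<close>. The matrix \<open>C\<close> has at least \<open>2 k\<close> rows
  \<open>(s, s\<^sup>2, \<dots>, s\<^sup>k, 0, \<dots>, 0)\<close> with distinct nonzero \<open>s\<close>, together with the unit rows
  \<open>e\<^sub>j\<close> for \<open>j > k\<close>. A polynomial of degree at most \<open>2 k\<close> without constant term that vanishes at
  all these \<open>s\<close> is zero, so the constraints say that the (weighted) antidiagonal sums of the
  leading block of \<open>Z\<close> vanish. Hence the matrices orthogonal to the affine space are of Hankel
  type on that block, with the entry at \<open>(0, 0)\<close> equal to zero. A positive semidefinite Hankel matrix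
  whose first diagonal entry vanishes is zero except in its last diagonal entry; so each
  facial reduction step is forced to remove exactly one coordinate, first \<open>k\<close>, then \<open>k - 1\<close>,
  down to \<open>1\<close>, and every facial reduction sequence has length \<open>k\<close>.\<close>

section \<open>Quadratic forms\<close>

text \<open>Vectors are plain functions of which only the values below \<open>p\<close> count, so
  test vectors need no carrier condition.\<close>

definition qform :: "nat \<Rightarrow> real mat \<Rightarrow> (nat \<Rightarrow> real) \<Rightarrow> real" where
  "qform p M v = (\<Sum>i<p. \<Sum>j<p. M $$ (i, j) * v i * v j)"

lemma sum_delta_pair:
  fixes f :: "nat \<Rightarrow> nat \<Rightarrow> real"
  assumes "a < p" "b < p"
  shows "(\<Sum>i<p. \<Sum>j<p. f i j * (if i = a \<and> j = b then 1 else 0)) = f a b"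
proof -
  have "(\<Sum>j<p. f i j * (if i = a \<and> j = b then 1 else 0)) = (if i = a then f a b else 0)" for i
    using assms by (simp add: if_distrib cong: if_cong)
  then show ?thesis
    using assms by simp
qed

text \<open>The trace pairs entry \<open>(i, j)\<close> of \<open>X\<close> with entry
  \<open>(j, i)\<close> of \<open>Y\<close>; symmetry of \<open>Y\<close> alone turns this into an
  entrywise sum.\<close>

lemma mat_inner_sym:
  assumes "X \<in> carrier_mat p p" "Y \<in> sym_mats p"
  shows "mat_inner X Y = (\<Sum>i<p. \<Sum>j<p. X $$ (i, j) * Y $$ (i, j))"
proof -
  have Y: "Y \<in> carrier_mat p p" "transpose_mat Y = Y"
    using assms(2) by (auto simp: sym_mats_def)
  have "Y $$ (j, i) = Y $$ (i, j)" if "i < p" "j < p" for i j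
    using Y that by (metis index_transpose_mat(1) carrier_matD)
  then show ?thesis
    using assms(1) Y(1)
    by (auto simp: mat_inner_def mat_trace_def scalar_prod_def atLeast0LessThan intro!: sum.cong)
qed

lemma sym_matsD:
  assumes "X \<in> sym_mats p"
  shows "X \<in> carrier_mat p p" "i < p \<Longrightarrow> j < p \<Longrightarrow> X $$ (j, i) = X $$ (i, j)"
  using assms unfolding sym_mats_def by (auto, metis index_transpose_mat(1) carrier_matD)

lemma sym_matsI:
  assumes "X \<in> carrier_mat p p" "\<And>i j. i < p \<Longrightarrow> j < p \<Longrightarrow> X $$ (j, i) = X $$ (i, j)"
  shows "X \<in> sym_mats p"
  using assms by (auto simp: sym_mats_def)

lemma mat_inner_commute:
  assumes "X \<in> sym_mats p" "Y \<in> sym_mats p"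
  shows "mat_inner X Y = mat_inner Y X"
  using assms by (simp add: mat_inner_sym[of _ p] sym_matsD(1) mult.commute)

lemma scalar_prod_qform:
  assumes "X \<in> carrier_mat p p" "v \<in> carrier_vec p"
  shows "v \<bullet> (X *\<^sub>v v) = qform p X (\<lambda>i. v $ i)"
  using assms
  by (auto simp: qform_def scalar_prod_def atLeast0LessThan sum_distrib_left ac_simps intro!: sum.cong)

lemma psd_mats_iff: "X \<in> psd_mats p \<longleftrightarrow> X \<in> sym_mats p \<and> (\<forall>v. 0 \<le> qform p X v)"
proof -
  have "0 \<le> qform p X v" if "X \<in> sym_mats p" "\<forall>v \<in> carrier_vec p. 0 \<le> v \<bullet> (X *\<^sub>v v)" for v
  proof -
    have "vec p v \<bullet> (X *\<^sub>v vec p v) = qform p X (\<lambda>i. vec p v $ i)"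
      using that by (intro scalar_prod_qform sym_matsD(1)) auto
    also have "\<dots> = qform p X v"
      by (auto simp: qform_def intro!: sum.cong)
    finally show ?thesis
      using that(2) vec_carrier by metis
  qed
  then show ?thesis
    by (auto simp: psd_mats_def scalar_prod_qform[of X p] sym_matsD(1))
qed

lemma qform_two_point:
  assumes "X \<in> sym_mats p" "a < p" "b < p"
  shows "qform p X (\<lambda>i. (if i = a then x else 0) + (if i = b then y else 0))
    = x\<^sup>2 * X $$ (a, a) + 2 * x * y * X $$ (a, b) + y\<^sup>2 * X $$ (b, b)"
proof -
  have "qform p X (\<lambda>i. (if i = a then x else 0) + (if i = b then y else 0))
    = (\<Sum>i<p. \<Sum>j<p. (x\<^sup>2 * X $$ (i, j)) * (if i = a \<and> j = a then 1 else 0))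
    + (\<Sum>i<p. \<Sum>j<p. (x * y * X $$ (i, j)) * (if i = a \<and> j = b then 1 else 0))
    + (\<Sum>i<p. \<Sum>j<p. (x * y * X $$ (i, j)) * (if i = b \<and> j = a then 1 else 0))
    + (\<Sum>i<p. \<Sum>j<p. (y\<^sup>2 * X $$ (i, j)) * (if i = b \<and> j = b then 1 else 0))"
    unfolding qform_def sum.distrib[symmetric]
    by (intro sum.cong refl) (auto simp: algebra_simps power2_eq_square)
  also have "\<dots> = x\<^sup>2 * X $$ (a, a) + x * y * X $$ (a, b) + x * y * X $$ (b, a) + y\<^sup>2 * X $$ (b, b)"
    using assms by (simp only: sum_delta_pair)
  finally show ?thesis
    using sym_matsD(2)[OF assms(1,2,3)] by simp
qed

section \<open>Diagonal entries of semidefinite matrices\<close>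

lemma affine_nonneg_imp_slope_zero:
  fixes c d :: real
  assumes "\<And>x. 0 \<le> c * x + d"
  shows "c = 0"
proof (rule ccontr)
  assume "c \<noteq> 0"
  then have "c * (- (d + 1) / c) + d = - 1"
    by simp
  then show False
    using assms[of "- (d + 1) / c"] by linarith
qed

text \<open>For \<open>y = 1\<close> the form is affine in \<open>x\<close> with slope
  \<open>2 * X $$ (a, b)\<close>. Nonnegativity is asked only on the plane of \<open>a\<close> and
  \<open>b\<close>, which makes the lemma applicable to matrices that are nonnegative merely on a
  face.\<close>

lemma zero_diag_imp_zero_entry:
  assumes "X \<in> sym_mats p" "a < p" "b < p" "X $$ (a, a) = 0"
    and nonneg: "\<And>x y. 0 \<le> qform p X (\<lambda>i. (if i = a then x else 0) + (if i = b then y else 0))"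
  shows "X $$ (a, b) = 0"
proof -
  have "0 \<le> (2 * X $$ (a, b)) * x + X $$ (b, b)" for x
    using nonneg[of x 1] unfolding qform_two_point[OF assms(1-3)] assms(4) by (simp add: mult_ac)
  from affine_nonneg_imp_slope_zero[OF this] show ?thesis
    by simp
qed

lemma psd_diag_nonneg:
  assumes "X \<in> psd_mats p" "a < p"
  shows "0 \<le> X $$ (a, a)"
proof -
  have "0 \<le> qform p X (\<lambda>i. (if i = a then 1 else 0) + (if i = a then 0 else 0))"
    using assms(1) by (simp add: psd_mats_iff)
  then show ?thesis
    using assms qform_two_point[of X p a a 1 0] by (simp add: psd_mats_iff)
qed

lemma psd_zero_diag:
  assumes "X \<in> psd_mats p" "a < p" "b < p" "X $$ (a, a) = 0"
  shows "X $$ (a, b) = 0" "X $$ (b, a) = 0"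
proof -
  have X: "X \<in> sym_mats p" "\<And>v. 0 \<le> qform p X v"
    using assms(1) unfolding psd_mats_iff by blast+
  show "X $$ (a, b) = 0"
    by (rule zero_diag_imp_zero_entry[OF X(1) assms(2-4) X(2)])
  then show "X $$ (b, a) = 0"
    using sym_matsD(2)[OF X(1) assms(2,3)] by simp
qed

section \<open>Rank-one matrices and nonnegative combinations\<close>

definition outer :: "nat \<Rightarrow> (nat \<Rightarrow> real) \<Rightarrow> real mat" where
  "outer p v = mat p p (\<lambda>(i, j). v i * v j)"

lemma outer_psd: "outer p v \<in> psd_mats p"
proof -
  have "qform p (outer p v) w = (\<Sum>i<p. v i * w i)\<^sup>2" for w
    unfolding qform_def power2_eq_square sum_product
    by (intro sum.cong refl) (simp add: outer_def mult_ac)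
  moreover have "outer p v \<in> sym_mats p"
    by (intro sym_matsI) (auto simp: outer_def)
  ultimately show ?thesis
    by (simp add: psd_mats_iff)
qed

text \<open>Translates membership in a dual cone into nonnegativity of the form at those
  \<open>v\<close> whose rank-one matrix lies in the face.\<close>

lemma mat_inner_outer:
  assumes "W \<in> carrier_mat p p"
  shows "mat_inner W (outer p v) = qform p W v"
proof -
  have sym: "outer p v \<in> sym_mats p"
    using outer_psd[of p v] unfolding psd_mats_iff by blast
  show ?thesis
    unfolding qform_def mat_inner_sym[OF assms sym]
    by (intro sum.cong refl) (simp add: outer_def)
qed

lemma sym_mats_comb:
  assumes "X \<in> sym_mats p" "Y \<in> sym_mats p"
  shows "s \<cdot>\<^sub>m X + t \<cdot>\<^sub>m Y \<in> sym_mats p"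
proof (rule sym_matsI)
  show "s \<cdot>\<^sub>m X + t \<cdot>\<^sub>m Y \<in> carrier_mat p p"
    using sym_matsD(1)[OF assms(1)] sym_matsD(1)[OF assms(2)] by simp
  show "(s \<cdot>\<^sub>m X + t \<cdot>\<^sub>m Y) $$ (j, i) = (s \<cdot>\<^sub>m X + t \<cdot>\<^sub>m Y) $$ (i, j)"
    if "i < p" "j < p" for i j
    using sym_matsD(1)[OF assms(1)] sym_matsD(1)[OF assms(2)] that
      sym_matsD(2)[OF assms(1) that] sym_matsD(2)[OF assms(2) that] by simp
qed

lemma qform_comb:
  assumes "X \<in> carrier_mat p p" "Y \<in> carrier_mat p p"
  shows "qform p (s \<cdot>\<^sub>m X + t \<cdot>\<^sub>m Y) v = s * qform p X v + t * qform p Y v"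
  using assms unfolding qform_def sum_distrib_left sum.distrib[symmetric]
  by (intro sum.cong refl) (simp add: algebra_simps)

lemma psd_mats_comb:
  assumes "X \<in> psd_mats p" "Y \<in> psd_mats p" "0 \<le> s" "0 \<le> t"
  shows "s \<cdot>\<^sub>m X + t \<cdot>\<^sub>m Y \<in> psd_mats p"
  using assms by (auto simp: psd_mats_iff sym_mats_comb qform_comb sym_matsD(1))

section \<open>Coordinate faces\<close>

text \<open>A zero diagonal entry of a semidefinite matrix kills its row and column, so for
  \<open>k < p\<close> these are the matrices supported on the coordinates up to \<open>q\<close>
  and beyond \<open>k\<close>; \<open>q = k\<close> gives the whole cone.\<close>

definition coord_face :: "nat \<Rightarrow> nat \<Rightarrow> nat \<Rightarrow> real mat set" where
  "coord_face p k q = {Z \<in> psd_mats p. \<forall>a. q < a \<and> a \<le> k \<longrightarrow> Z $$ (a, a) = 0}"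

lemma coord_face_zero_entry:
  assumes "Z \<in> coord_face p k q" "k < p" "q < a" "a \<le> k" "b < p"
  shows "Z $$ (a, b) = 0" "Z $$ (b, a) = 0"
  using assms psd_zero_diag[of Z p a b] by (auto simp: coord_face_def)

text \<open>Diagonal entries are nonnegative, so a combination of two of them with positive weights
  is zero only if both are.\<close>

lemma coord_face_is_face:
  assumes "k < p"
  shows "is_face (coord_face p k q) (psd_mats p)"
  unfolding is_face_def mat_convex_def
proof (intro conjI ballI allI impI)
  show "coord_face p k q \<subseteq> psd_mats p"
    by (auto simp: coord_face_def)
next
  fix X Y t
  assume *: "X \<in> coord_face p k q" "Y \<in> coord_face p k q" "0 \<le> t \<and> t \<le> (1::real)"
  then have "X \<in> carrier_mat p p" "Y \<in> carrier_mat p p"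
    by (auto simp: coord_face_def psd_mats_iff sym_matsD(1))
  with * assms show "t \<cdot>\<^sub>m X + (1 - t) \<cdot>\<^sub>m Y \<in> coord_face p k q"
    by (auto simp: coord_face_def psd_mats_comb)
next
  fix X Y t
  assume *: "X \<in> psd_mats p" "Y \<in> psd_mats p"
    "0 < t \<and> t < (1::real) \<and> t \<cdot>\<^sub>m X + (1 - t) \<cdot>\<^sub>m Y \<in> coord_face p k q"
  then have c: "X \<in> carrier_mat p p" "Y \<in> carrier_mat p p"
    by (auto simp: psd_mats_iff sym_matsD(1))
  have "X $$ (a, a) = 0 \<and> Y $$ (a, a) = 0" if "q < a" "a \<le> k" for a
  proof -
    have "(t \<cdot>\<^sub>m X + (1 - t) \<cdot>\<^sub>m Y) $$ (a, a) = 0"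
      using *(3) that unfolding coord_face_def by blast
    then have "t * X $$ (a, a) + (1 - t) * Y $$ (a, a) = 0"
      using c that assms by simp
    moreover have "0 \<le> X $$ (a, a)" "0 \<le> Y $$ (a, a)"
      using *(1,2) that assms by (auto intro: psd_diag_nonneg)
    ultimately have "t * X $$ (a, a) = 0" "(1 - t) * Y $$ (a, a) = 0"
      using *(3) add_nonneg_eq_0_iff[of "t * X $$ (a, a)" "(1 - t) * Y $$ (a, a)"] by auto
    then show ?thesis
      using *(3) by auto
  qed
  then show "X \<in> coord_face p k q" "Y \<in> coord_face p k q"
    using *(1,2) unfolding coord_face_def by blast+
qed

text \<open>\<open>Z\<close> vanishes on the removed coordinates and \<open>W\<close> on all other
  positions except \<open>(q, q)\<close>, so one product survives.\<close>

lemma mat_inner_single_entry: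
  assumes W: "W \<in> carrier_mat p p" and Z: "Z \<in> coord_face p k q" and "k < p" "q \<le> k"
    and zero: "\<And>a b. a < p \<Longrightarrow> b < p \<Longrightarrow> a \<le> q \<or> k < a \<Longrightarrow> b \<le> q \<or> k < b
      \<Longrightarrow> (a, b) \<noteq> (q, q) \<Longrightarrow> W $$ (a, b) = 0"
  shows "mat_inner W Z = W $$ (q, q) * Z $$ (q, q)"
proof -
  have entry: "W $$ (i, j) * Z $$ (i, j) = (W $$ (i, j) * Z $$ (i, j)) * (if i = q \<and> j = q then 1 else 0)"
    if "i < p" "j < p" for i j
  proof (cases "(i \<le> q \<or> k < i) \<and> (j \<le> q \<or> k < j)")
    case True
    then show ?thesis
      using zero[of i j] that by auto
  next
    case False
    then have "Z $$ (i, j) = 0"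
      using coord_face_zero_entry[OF Z \<open>k < p\<close>] that by (meson not_le)
    then show ?thesis
      by simp
  qed
  have sym: "Z \<in> sym_mats p"
    using Z by (simp add: coord_face_def psd_mats_iff)
  have "mat_inner W Z
    = (\<Sum>i<p. \<Sum>j<p. (W $$ (i, j) * Z $$ (i, j)) * (if i = q \<and> j = q then 1 else 0))"
    unfolding mat_inner_sym[OF W sym] by (intro sum.cong refl entry) auto
  also have "\<dots> = W $$ (q, q) * Z $$ (q, q)"
    using assms(3,4) by (intro sum_delta_pair) auto
  finally show ?thesis .
qed

lemma outer_unit_coord_face:
  "q \<le> k \<Longrightarrow> k < p \<Longrightarrow> outer p (\<lambda>i. if i = q then 1 else 0) \<in> coord_face p k q"
  by (auto simp: coord_face_def outer_psd) (auto simp: outer_def)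

lemma coord_face_neq:
  assumes "q' < q" "q \<le> k" "k < p"
  shows "coord_face p k q \<noteq> coord_face p k q'"
proof -
  let ?E = "outer p (\<lambda>i. if i = q then 1 else 0)"
  have "?E \<notin> coord_face p k q'"
    using assms by (auto simp: coord_face_def outer_def)
  with outer_unit_coord_face assms show ?thesis
    by blast
qed

section \<open>The affine space of the moment configuration\<close>

text \<open>The weights are chosen such that \<open>Phi (s, s\<^sup>2, \<dots>, s\<^sup>k, 0, \<dots>, 0)\<close> has the entries
  \<open>coef k a b * s ^ (a + b)\<close>.\<close>

definition coef :: "nat \<Rightarrow> nat \<Rightarrow> nat \<Rightarrow> real" where
  "coef k a b = (if (a = 0 \<and> b = 0) \<or> k < a \<or> k < b then 0 else if a = 0 \<or> b = 0 then - 1 / 2 else 1)"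

text \<open>The coefficient of \<open>s ^ t\<close> in \<open>Phi\<close> of the moment row at
  \<open>s\<close>; it is zero for \<open>t = 0\<close>.\<close>

definition antidiag :: "nat \<Rightarrow> nat \<Rightarrow> nat \<Rightarrow> real mat" where
  "antidiag p k t = mat p p (\<lambda>(a, b). if a + b = t then coef k a b else 0)"

text \<open>A form of the constraints free of the points \<open>s\<close>: the moment rows become
  one equation per antidiagonal, and a unit row becomes
  \<open>Z $$ (j, j) = Z $$ (0, j)\<close>.\<close>

definition moment_affine :: "nat \<Rightarrow> nat \<Rightarrow> real mat set" where
  "moment_affine p k = {Z \<in> sym_mats p. Z $$ (0, 0) = 1 \<and>
     (\<forall>t\<le>2 * k. mat_inner (antidiag p k t) Z = 0) \<and>
     (\<forall>j. k < j \<and> j < p \<longrightarrow> Z $$ (j, j) = Z $$ (0, j))}"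

lemma coef_sym: "coef k a b = coef k b a"
  by (auto simp: coef_def)

lemma antidiag_sym: "antidiag p k t \<in> sym_mats p"
  by (auto simp: antidiag_def coef_sym add.commute intro!: sym_matsI)

lemma antidiag_carrier [simp]: "antidiag p k t \<in> carrier_mat p p"
  by (simp add: antidiag_def)

text \<open>Sparse points of the affine space from which linear relations between the entries of an
  orthogonal matrix are read off. For \<open>a = b\<close> the diagonal entry receives
  \<open>2 * x\<close>.\<close>

definition test_mat :: "nat \<Rightarrow> real \<Rightarrow> nat \<Rightarrow> nat \<Rightarrow> real \<Rightarrow> nat \<Rightarrow> nat \<Rightarrow> real mat" where
  "test_mat p x a b y c d = mat p p (\<lambda>(i, j). (if i = 0 \<and> j = 0 then 1 else 0)
     + x * ((if i = a \<and> j = b then 1 else 0) + (if i = b \<and> j = a then 1 else 0))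
     + y * ((if i = c \<and> j = d then 1 else 0) + (if i = d \<and> j = c then 1 else 0)))"

lemma test_mat_sym: "test_mat p x a b y c d \<in> sym_mats p"
  by (rule sym_matsI) (simp_all add: test_mat_def conj_commute add.commute)

lemma mat_inner_test_mat:
  assumes W: "W \<in> sym_mats p" and "a < p" "b < p" "c < p" "d < p"
  shows "mat_inner W (test_mat p x a b y c d)
    = W $$ (0, 0) + 2 * x * W $$ (a, b) + 2 * y * W $$ (c, d)"
proof -
  have "mat_inner W (test_mat p x a b y c d)
    = (\<Sum>i<p. \<Sum>j<p. W $$ (i, j) * (if i = 0 \<and> j = 0 then 1 else 0))
    + (\<Sum>i<p. \<Sum>j<p. (x * W $$ (i, j)) * (if i = a \<and> j = b then 1 else 0))
    + (\<Sum>i<p. \<Sum>j<p. (x * W $$ (i, j)) * (if i = b \<and> j = a then 1 else 0))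
    + (\<Sum>i<p. \<Sum>j<p. (y * W $$ (i, j)) * (if i = c \<and> j = d then 1 else 0))
    + (\<Sum>i<p. \<Sum>j<p. (y * W $$ (i, j)) * (if i = d \<and> j = c then 1 else 0))"
    unfolding sum.distrib[symmetric] mat_inner_sym[OF sym_matsD(1)[OF W] test_mat_sym]
    by (intro sum.cong refl) (simp add: test_mat_def algebra_simps split del: if_split)
  also have "\<dots> = W $$ (0, 0) + x * W $$ (a, b) + x * W $$ (b, a) + y * W $$ (c, d) + y * W $$ (d, c)"
    using assms by (subst sum_delta_pair, simp_all)+
  finally show ?thesis
    using sym_matsD(2)[OF W assms(2,3)] sym_matsD(2)[OF W assms(4,5)] by simp
qed

text \<open>The pairing with an antidiagonal matrix is twice the weighted sum of the chosen entries,
  so these have to cancel on each antidiagonal; \<open>0 < b\<close> and \<open>0 < d\<close>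
  protect the entry 1 at \<open>(0, 0)\<close>.\<close>

lemma test_mat_affine:
  assumes "a < p" "b < p" "c < p" "d < p" "0 < b" "0 < d" "k < p"
    and "\<And>t. t \<le> 2 * k \<Longrightarrow> x * (if a + b = t then coef k a b else 0)
      + y * (if c + d = t then coef k c d else 0) = 0"
    and "\<And>j. k < j \<Longrightarrow> j < p \<Longrightarrow> test_mat p x a b y c d $$ (j, j) = test_mat p x a b y c d $$ (0, j)"
  shows "test_mat p x a b y c d \<in> moment_affine p k"
proof -
  have "mat_inner (antidiag p k t) (test_mat p x a b y c d) = 0" if "t \<le> 2 * k" for t
  proof -
    have "mat_inner (antidiag p k t) (test_mat p x a b y c d)
      = 2 * (x * (if a + b = t then coef k a b else 0) + y * (if c + d = t then coef k c d else 0))"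
      using assms(1-7) by (subst mat_inner_test_mat[OF antidiag_sym])
        (auto simp: antidiag_def coef_def algebra_simps)
    then show ?thesis
      using assms(8)[OF that] by simp
  qed
  moreover have "test_mat p x a b y c d $$ (0, 0) = 1"
    using assms(1-7) by (auto simp: test_mat_def)
  ultimately show ?thesis
    using assms(9) by (auto simp: moment_affine_def test_mat_sym)
qed

lemma perp_test_mat:
  assumes "W \<in> perp p (moment_affine p k)" "test_mat p x a b y c d \<in> moment_affine p k"
    and "a < p" "b < p" "c < p" "d < p"
  shows "W $$ (0, 0) + 2 * x * W $$ (a, b) + 2 * y * W $$ (c, d) = 0"
  using assms mat_inner_test_mat[of W p a b c d x y] by (auto simp: perp_def)

text \<open>The matrix whose only nonzero entry is 1 at \<open>(0, 0)\<close> is itself a point of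
  the affine space, and the complement is orthogonal to points, not only to directions.\<close>

lemma perp_moment_affine_00:
  assumes "W \<in> perp p (moment_affine p k)" "k < p"
  shows "W $$ (0, 0) = 0"
proof -
  let ?Z = "test_mat p 0 0 0 0 0 0"
  have "mat_inner (antidiag p k t) ?Z = 0" for t
    using assms(2) by (subst mat_inner_test_mat[OF antidiag_sym]) (auto simp: antidiag_def coef_def)
  moreover have "?Z $$ (0, 0) = 1" "\<And>j. k < j \<Longrightarrow> j < p \<Longrightarrow> ?Z $$ (j, j) = ?Z $$ (0, j)"
    using assms(2) by (auto simp: test_mat_def)
  ultimately have "?Z \<in> moment_affine p k"
    unfolding moment_affine_def using test_mat_sym by blast
  from perp_test_mat[OF assms(1) this] show ?thesis
    using assms(2) by simp
qed

text \<open>The Hankel relation: both positions lie on antidiagonal \<open>2 * a\<close>, and weight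
  can be shifted between them inside the affine space. The bound \<open>a < k\<close> keeps
  \<open>a + 1\<close> in the leading block.\<close>

lemma perp_moment_affine_diag:
  assumes W: "W \<in> perp p (moment_affine p k)" "k < p" and a: "0 < a" "a < k"
  shows "coef k (a - 1) (a + 1) * W $$ (a, a) = W $$ (a - 1, a + 1)"
proof -
  have "test_mat p (coef k (a - 1) (a + 1)) a a (- 1) (a - 1) (a + 1) \<in> moment_affine p k"
    using assms by (intro test_mat_affine) (auto simp: test_mat_def coef_def)
  from perp_test_mat[OF W(1) this] show ?thesis
    using perp_moment_affine_00[OF W] assms by simp
qed

lemma perp_moment_affine_tail:
  assumes W: "W \<in> perp p (moment_affine p k)" "k < p" and a: "k < a" "a < p"
  shows "W $$ (a, a) = - 2 * W $$ (0, a)"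
proof -
  \<comment> \<open>The diagonal term counts twice, so the weights 1 and 2 make both entries equal
    to 2, as the tail equation demands.\<close>
  have "test_mat p 1 a a 2 0 a \<in> moment_affine p k"
    using assms by (intro test_mat_affine) (auto simp: test_mat_def coef_def)
  from perp_test_mat[OF W(1) this] show ?thesis
    using perp_moment_affine_00[OF W] assms by simp
qed

section \<open>Facial reduction steps\<close>

text \<open>On the coordinate face, the diagonal of an exposing matrix
  vanishes at \<open>0\<close>, hence by the Hankel structure successively at \<open>1, \<dots>, q - 1\<close>, and only
  the entry at \<open>(q, q)\<close> survives.\<close>

lemma exposing_on_coord_face:
  assumes W: "W \<in> perp p (moment_affine p k)" "W \<in> dual_cone p (coord_face p k q)"
    and "k < p" "q \<le> k" and Z: "Z \<in> coord_face p k q"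
  shows "mat_inner W Z = W $$ (q, q) * Z $$ (q, q)"
proof -
  \<comment> \<open>The coordinates alive on the face: two-point vectors supported there give
    rank-one members of the face, on which \<open>W\<close> is nonnegative.\<close>
  define A where "A = {a. a < p \<and> (a \<le> q \<or> k < a)}"
  have sym: "W \<in> sym_mats p"
    using W(1) by (simp add: perp_def)
  have zero: "W $$ (a, b) = 0" if "a \<in> A" "b \<in> A" "W $$ (a, a) = 0" for a b
  proof (rule zero_diag_imp_zero_entry[OF sym])
    fix x y :: real
    let ?v = "\<lambda>i. (if i = a then x else 0) + (if i = b then y else 0)"
    have "outer p ?v \<in> coord_face p k q"
      using that \<open>k < p\<close> by (auto simp: coord_face_def outer_psd) (auto simp: outer_def A_def)
    then have "0 \<le> mat_inner W (outer p ?v)"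
      using W(2) by (auto simp: dual_cone_def)
    then show "0 \<le> qform p W ?v"
      using sym by (simp add: mat_inner_outer sym_matsD(1))
  qed (use that in \<open>auto simp: A_def\<close>)
  have row0: "W $$ (0, b) = 0" if "b \<in> A" for b
    using zero[of 0 b] that perp_moment_affine_00[OF W(1) \<open>k < p\<close>] \<open>k < p\<close> by (auto simp: A_def)
  have low: "a < q \<Longrightarrow> b \<in> A \<Longrightarrow> W $$ (a, b) = 0" for a b
  proof (induction a arbitrary: b)
    case 0
    then show ?case
      using row0 by simp
  next
    case (Suc a)
    \<comment> \<open>Row \<open>a\<close> is already zero and \<open>a + 2 \<le> q\<close> is
      alive, so the Hankel relation carries the zero to the next diagonal entry. At \<open>q\<close>
      this stops: \<open>q + 1\<close> is removed or, if \<open>q = k\<close>, lies outside the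
      Hankel block.\<close>
    have "W $$ (a, a + 2) = 0"
      using Suc assms(3,4) by (intro Suc.IH) (auto simp: A_def)
    moreover have "coef k a (a + 2) \<noteq> 0"
      using Suc.prems assms(4) by (auto simp: coef_def)
    ultimately have diag: "W $$ (Suc a, Suc a) = 0"
      using perp_moment_affine_diag[OF W(1) \<open>k < p\<close>, of "Suc a"] Suc.prems assms(4) by auto
    show ?case
      by (rule zero) (use diag Suc.prems assms(3,4) in \<open>auto simp: A_def\<close>)
  qed
  \<comment> \<open>Beyond \<open>k\<close> the diagonal entry is a multiple of an entry of row 0,
    which is zero.\<close>
  have high: "W $$ (a, b) = 0" if "a \<in> A" "k < a" "b \<in> A" for a b
    by (rule zero)
      (use that perp_moment_affine_tail[OF W(1) \<open>k < p\<close>, of a] row0[of a] in \<open>auto simp: A_def\<close>)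
  have "W $$ (a, b) = 0" if ab: "a \<in> A" "b \<in> A" "(a, b) \<noteq> (q, q)" for a b
  proof -
    consider "a < q" | "k < a" | "b < q" | "k < b"
      using ab \<open>q \<le> k\<close> by (auto simp: A_def)
    then show ?thesis
    proof cases
      case 3
      then show ?thesis
        using low[of b a] ab sym_matsD(2)[OF sym, of a b] by (auto simp: A_def)
    next
      case 4
      then show ?thesis
        using high[of b a] ab sym_matsD(2)[OF sym, of a b] by (auto simp: A_def)
    qed (use low high ab in auto)
  qed
  then show ?thesis
    using Z assms(3,4) sym by (intro mat_inner_single_entry) (auto simp: A_def sym_matsD(1))
qed

text \<open>On the face, \<open>W\<close> acts through its entry at \<open>(q, q)\<close> alone. Not
  being orthogonal to the face makes that entry nonzero, which rules out \<open>q = 0\<close> and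
  means that the cut removes exactly coordinate \<open>q\<close>.\<close>

lemma facial_step_forced:
  assumes W: "W \<in> perp p (moment_affine p k)"
      "W \<in> dual_cone p (coord_face p k q)" "W \<notin> perp p (coord_face p k q)"
    and "k < p" "q \<le> k"
  shows "0 < q" "coord_face p k q \<inter> perp p {W} = coord_face p k (q - 1)"
proof -
  note ip = exposing_on_coord_face[OF W(1,2) \<open>k < p\<close> \<open>q \<le> k\<close>]
  have sym: "W \<in> sym_mats p"
    using W(1) by (simp add: perp_def)
  have nz: "W $$ (q, q) \<noteq> 0"
    using W(3) sym ip by (auto simp: perp_def)
  then show "0 < q"
    using perp_moment_affine_00[OF W(1) \<open>k < p\<close>] by (cases q) auto
  then have *: "q - 1 < a \<and> a \<le> k \<longleftrightarrow> q < a \<and> a \<le> k \<or> a = q" for a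
    using \<open>q \<le> k\<close> by auto
  have "coord_face p k q \<inter> perp p {W} = {Z \<in> coord_face p k q. W $$ (q, q) * Z $$ (q, q) = 0}"
  proof -
    have "Z \<in> sym_mats p" "mat_inner Z W = W $$ (q, q) * Z $$ (q, q)" if "Z \<in> coord_face p k q" for Z
    proof -
      show "Z \<in> sym_mats p"
        using that by (simp add: coord_face_def psd_mats_iff)
      then show "mat_inner Z W = W $$ (q, q) * Z $$ (q, q)"
        using ip[OF that] mat_inner_commute[OF _ sym] by simp
    qed
    then show ?thesis
      unfolding perp_def by auto
  qed
  also have "\<dots> = coord_face p k (q - 1)"
    using nz unfolding coord_face_def * by auto
  finally show "coord_face p k q \<inter> perp p {W} = coord_face p k (q - 1)" .
qed

text \<open>Any other position on antidiagonal \<open>2 * q\<close> has an index above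
  \<open>q\<close>, hence removed or of weight zero.\<close>

lemma antidiag_on_coord_face:
  assumes "Z \<in> coord_face p k q" "k < p" "0 < q" "q \<le> k"
  shows "mat_inner (antidiag p k (2 * q)) Z = Z $$ (q, q)"
proof -
  have "mat_inner (antidiag p k (2 * q)) Z = antidiag p k (2 * q) $$ (q, q) * Z $$ (q, q)"
    using assms by (intro mat_inner_single_entry) (auto simp: antidiag_def coef_def)
  then show ?thesis
    using assms by (auto simp: antidiag_def coef_def)
qed

lemma antidiag_perp:
  assumes "t \<le> 2 * k"
  shows "antidiag p k t \<in> perp p (moment_affine p k)"
  using assms by (auto simp: perp_def moment_affine_def antidiag_sym)

lemma antidiag_exposes:
  assumes "k < p" "0 < q" "q \<le> k"
  shows "antidiag p k (2 * q) \<in> dual_cone p (coord_face p k q)"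
    and "antidiag p k (2 * q) \<notin> perp p (coord_face p k q)"
proof -
  have "0 \<le> mat_inner (antidiag p k (2 * q)) Z" if "Z \<in> coord_face p k q" for Z
    using assms that by (auto simp: antidiag_on_coord_face coord_face_def intro: psd_diag_nonneg)
  then show "antidiag p k (2 * q) \<in> dual_cone p (coord_face p k q)"
    by (auto simp: dual_cone_def antidiag_sym)
next
  have "mat_inner (antidiag p k (2 * q)) (outer p (\<lambda>i. if i = q then 1 else 0)) = 1"
    using assms by (subst antidiag_on_coord_face[OF outer_unit_coord_face]) (auto simp: outer_def)
  then show "antidiag p k (2 * q) \<notin> perp p (coord_face p k q)"
    using outer_unit_coord_face[of q k p] assms by (force simp: perp_def)
qed

text \<open>The matrices that cut are orthogonal to the affine space, so a feasible point survives
  every cut; \<open>j\<close> counts the removed coordinates, from \<open>k\<close>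
  downwards.\<close>

lemma moment_affine_psd_coord_face:
  assumes "k < p" "Z \<in> moment_affine p k" "Z \<in> psd_mats p"
  shows "j \<le> k \<Longrightarrow> Z \<in> coord_face p k (k - j)"
proof (induction j)
  case 0
  then show ?case
    using assms by (auto simp: coord_face_def)
next
  case (Suc j)
  define q where "q = k - j"
  have q: "0 < q" "q \<le> k" "k - Suc j = q - 1"
    using Suc.prems by (auto simp: q_def)
  have Z: "Z \<in> coord_face p k q"
    using Suc by (auto simp: q_def)
  have "antidiag p k (2 * q) \<in> perp p (moment_affine p k)"
    using q by (intro antidiag_perp) auto
  moreover from this have "Z \<in> perp p {antidiag p k (2 * q)}"
    using assms by (auto simp: perp_def moment_affine_def mat_inner_commute[OF _ antidiag_sym])
  ultimately show ?case
    using facial_step_forced(2)[OF _ antidiag_exposes] q Z \<open>k < p\<close> by auto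
qed

section \<open>The minimal face\<close>

lemma qform_le_sum_squares:
  assumes "X \<in> carrier_mat p p"
  shows "\<exists>B>0. \<forall>v. qform p X v \<le> B * (\<Sum>i<p. (v i)\<^sup>2)"
proof -
  define M where "M = (\<Sum>i<p. \<Sum>j<p. \<bar>X $$ (i, j)\<bar>)"
  \<comment> \<open>The added 1 makes the constant positive even for \<open>X = 0\<close>.\<close>
  have "qform p X v \<le> (M + 1) * (\<Sum>i<p. (v i)\<^sup>2)" for v
  proof -
    define S where "S = (\<Sum>i<p. (v i)\<^sup>2)"
    have S: "0 \<le> S"
      by (auto simp: S_def intro!: sum_nonneg)
    have "X $$ (i, j) * v i * v j \<le> \<bar>X $$ (i, j)\<bar> * S" if "i < p" "j < p" for i j
    proof -
      have le: "(v i)\<^sup>2 \<le> S" if "i < p" for i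
        unfolding S_def using that by (intro member_le_sum) auto
      have "2 * (\<bar>v i\<bar> * \<bar>v j\<bar>) \<le> (v i)\<^sup>2 + (v j)\<^sup>2"
        using sum_squares_bound[of "\<bar>v i\<bar>" "\<bar>v j\<bar>"] by (simp add: ac_simps)
      with le[OF that(1)] le[OF that(2)] have "\<bar>v i * v j\<bar> \<le> S"
        unfolding abs_mult by linarith
      then have "\<bar>X $$ (i, j)\<bar> * \<bar>v i * v j\<bar> \<le> \<bar>X $$ (i, j)\<bar> * S"
        by (intro mult_left_mono) auto
      moreover have "X $$ (i, j) * v i * v j \<le> \<bar>X $$ (i, j)\<bar> * \<bar>v i * v j\<bar>"
        by (metis abs_ge_self abs_mult mult.assoc)
      ultimately show ?thesis
        by linarith
    qed
    then have "qform p X v \<le> (\<Sum>i<p. \<Sum>j<p. \<bar>X $$ (i, j)\<bar> * S)"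
      unfolding qform_def by (intro sum_mono) auto
    also have "\<dots> = M * S"
      by (simp add: M_def sum_distrib_right)
    also have "\<dots> \<le> (M + 1) * S"
      using S by (simp add: algebra_simps)
    finally show ?thesis
      by (simp add: S_def)
  qed
  moreover have "0 < M + 1"
    by (auto simp: M_def intro!: add_nonneg_pos sum_nonneg)
  ultimately show ?thesis
    by blast
qed

text \<open>A point of the affine space in the relative interior of the minimal face, for small
  positive \<open>e\<close>.\<close>

definition center :: "nat \<Rightarrow> nat \<Rightarrow> real \<Rightarrow> real mat" where
  "center p k e = mat p p (\<lambda>(i, j). if i = 0 \<and> j = 0 then 1
     else if (i = 0 \<and> k < j) \<or> (j = 0 \<and> k < i) \<or> (i = j \<and> k < i) then e else 0)"

lemma qform_center:
  assumes "k < p"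
  shows "qform p (center p k e) v
    = (v 0)\<^sup>2 + e * (\<Sum>j | k < j \<and> j < p. 2 * v 0 * v j + (v j)\<^sup>2)"
proof -
  define R where "R = {j. k < j \<and> j < p}"
  have R: "finite R" "R \<subseteq> {..<p}" "0 \<notin> R"
    by (auto simp: R_def)
  have sumR: "(\<Sum>j<p. if k < j then f j else 0) = (\<Sum>j\<in>R. f j)" for f :: "nat \<Rightarrow> real"
    unfolding R_def by (subst sum.inter_filter[symmetric]) (auto intro!: sum.cong)
  have row: "(\<Sum>j<p. center p k e $$ (i, j) * v i * v j) =
    (if i = 0 then (v 0)\<^sup>2 + e * v 0 * (\<Sum>j\<in>R. v j) else 0)
    + (if k < i then e * (v 0 * v i + (v i)\<^sup>2) else 0)" if "i < p" for i
  proof -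
    have "(\<Sum>j<p. center p k e $$ (i, j) * v i * v j) =
      (\<Sum>j<p. (if j = 0 then (if i = 0 then (v 0)\<^sup>2 else if k < i then e * v 0 * v i else 0) else 0)
        + (if k < j then (if i = 0 then e * v 0 * v j else 0) else 0)
        + (if j = i then (if k < i then e * (v i)\<^sup>2 else 0) else 0))"
      using that by (intro sum.cong refl) (auto simp: center_def power2_eq_square)
    also have "\<dots> = (if i = 0 then (v 0)\<^sup>2 else if k < i then e * v 0 * v i else 0)
        + (\<Sum>j\<in>R. (if i = 0 then e * v 0 * v j else 0))
        + (if k < i then e * (v i)\<^sup>2 else 0)"
      using that assms by (simp add: sum.distrib sumR)
    also have "\<dots> = (if i = 0 then (v 0)\<^sup>2 + e * v 0 * (\<Sum>j\<in>R. v j) else 0)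
      + (if k < i then e * (v 0 * v i + (v i)\<^sup>2) else 0)"
      by (auto simp: sum_distrib_left algebra_simps)
    finally show ?thesis .
  qed
  have "qform p (center p k e) v = (\<Sum>i<p. (if i = 0 then (v 0)\<^sup>2 + e * v 0 * (\<Sum>j\<in>R. v j) else 0)
    + (if k < i then e * (v 0 * v i + (v i)\<^sup>2) else 0))"
    unfolding qform_def using row by (intro sum.cong) auto
  also have "\<dots> = (v 0)\<^sup>2 + e * v 0 * (\<Sum>j\<in>R. v j) + (\<Sum>i\<in>R. e * (v 0 * v i + (v i)\<^sup>2))"
    using assms by (simp add: sum.distrib sumR)
  also have "\<dots> = (v 0)\<^sup>2 + e * (\<Sum>j\<in>R. 2 * v 0 * v j + (v j)\<^sup>2)"
    by (simp add: sum_distrib_left sum.distrib algebra_simps)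
  finally show ?thesis
    by (simp add: R_def)
qed

text \<open>Positive definiteness on the surviving coordinates. Completing the square in
  \<open>2 * v 0 + v j\<close> costs \<open>2 * (v 0)\<^sup>2\<close> for each of at most
  \<open>p - 1\<close> tail coordinates, and the choice of \<open>e\<close> lets the term
  \<open>(v 0)\<^sup>2\<close> pay for this.\<close>

lemma qform_center_ge:
  assumes "k < p" and e: "e = 1 / (2 * real p)"
  shows "(e / 2) * ((v 0)\<^sup>2 + (\<Sum>j | k < j \<and> j < p. (v j)\<^sup>2)) \<le> qform p (center p k e) v"
proof -
  define R where "R = {j. k < j \<and> j < p}"
  have "card R \<le> card {1..<p}"
    by (intro card_mono) (auto simp: R_def)
  then have card: "real (card R) \<le> real p - 1"
    using assms(1) by auto
  have e0: "0 < e"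
    using assms by auto
  have "(v j)\<^sup>2 / 2 - 2 * (v 0)\<^sup>2 \<le> 2 * v 0 * v j + (v j)\<^sup>2" for j
    using zero_le_power2[of "2 * v 0 + v j"] by (simp add: power2_sum algebra_simps power2_eq_square)
  then have "(\<Sum>j\<in>R. (v j)\<^sup>2 / 2 - 2 * (v 0)\<^sup>2) \<le> (\<Sum>j\<in>R. 2 * v 0 * v j + (v j)\<^sup>2)"
    by (intro sum_mono)
  then have "e * (\<Sum>j\<in>R. (v j)\<^sup>2 / 2 - 2 * (v 0)\<^sup>2) \<le> e * (\<Sum>j\<in>R. 2 * v 0 * v j + (v j)\<^sup>2)"
    using e0 by (intro mult_left_mono) auto
  moreover have "e * (\<Sum>j\<in>R. (v j)\<^sup>2 / 2 - 2 * (v 0)\<^sup>2)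
    = (e / 2) * (\<Sum>j\<in>R. (v j)\<^sup>2) - (2 * e * real (card R)) * (v 0)\<^sup>2"
    by (simp add: sum_subtractf sum_divide_distrib[symmetric] algebra_simps)
  moreover have "(e / 2 + 2 * e * real (card R)) * (v 0)\<^sup>2 \<le> 1 * (v 0)\<^sup>2"
  proof (intro mult_right_mono)
    have "e / 2 + 2 * e * real (card R) \<le> e / 2 + 2 * e * (real p - 1)"
      using card e0 by (intro add_left_mono mult_left_mono) auto
    also have "\<dots> \<le> 2 * e * real p"
      using e0 by (simp add: algebra_simps)
    also have "\<dots> = 1"
      using assms by simp
    finally show "e / 2 + 2 * e * real (card R) \<le> 1" .
  qed auto
  ultimately show ?thesis
    unfolding qform_center[OF assms(1)] R_def[symmetric] by (simp add: algebra_simps)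
qed

lemma center_sym: "center p k e \<in> sym_mats p"
  by (auto simp: center_def intro!: sym_matsI)

lemma center_psd:
  assumes "k < p" "e = 1 / (2 * real p)"
  shows "center p k e \<in> psd_mats p"
proof -
  have nonneg: "0 \<le> (e / 2) * ((v 0)\<^sup>2 + (\<Sum>j | k < j \<and> j < p. (v j)\<^sup>2))" for v
    using assms by (intro mult_nonneg_nonneg add_nonneg_nonneg sum_nonneg) auto
  have "0 \<le> qform p (center p k e) v" for v
    by (rule order_trans[OF nonneg[of v] qform_center_ge[OF assms, of v]])
  then show ?thesis
    by (simp add: psd_mats_iff center_sym)
qed

lemma center_affine:
  assumes "k < p"
  shows "center p k e \<in> moment_affine p k"
proof -
  have "mat_inner (antidiag p k t) (center p k e) = 0" for t
    by (subst mat_inner_sym[OF antidiag_carrier center_sym], intro sum.neutral ballI)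
      (auto simp: antidiag_def center_def coef_def)
  with assms show ?thesis
    by (auto simp: moment_affine_def center_sym) (auto simp: center_def)
qed

text \<open>The relative interior property: the form of \<open>Y\<close> is bounded above, and that
  of the center below, by multiples of the same sum of squares, so a small multiple of
  \<open>Y\<close> can be split off.\<close>

lemma center_minus_psd:
  assumes "k < p" "e = 1 / (2 * real p)" "Y \<in> coord_face p k 0"
  shows "\<exists>t X. 0 < t \<and> t < 1 \<and> X \<in> psd_mats p \<and> center p k e = t \<cdot>\<^sub>m Y + (1 - t) \<cdot>\<^sub>m X"
proof -
  have Y: "Y \<in> sym_mats p" "Y \<in> carrier_mat p p"
    using assms(3) by (auto simp: coord_face_def psd_mats_iff sym_matsD(1))
  obtain B where B: "0 < B" "\<And>v. qform p Y v \<le> B * (\<Sum>i<p. (v i)\<^sup>2)"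
    using qform_le_sum_squares[OF Y(2)] by blast
  have qY: "qform p Y v \<le> B * ((v 0)\<^sup>2 + (\<Sum>j | k < j \<and> j < p. (v j)\<^sup>2))" for v
  proof -
    \<comment> \<open>Deleting the coordinates on which \<open>Y\<close> vanishes leaves its form
      unchanged and restricts the bound to the surviving ones.\<close>
    define w where "w i = (if 0 < i \<and> i \<le> k then 0 else v i)" for i
    have "qform p Y v = qform p Y w"
      unfolding qform_def using coord_face_zero_entry[OF assms(3,1)]
      by (intro sum.cong refl) (auto simp: w_def)
    also have "\<dots> \<le> B * (\<Sum>i<p. (w i)\<^sup>2)"
      by (rule B(2))
    also have "(\<Sum>i<p. (w i)\<^sup>2) = (\<Sum>i\<in>insert 0 {j. k < j \<and> j < p}. (w i)\<^sup>2)"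
      using assms(1) by (intro sum.mono_neutral_right) (auto simp: w_def)
    also have "\<dots> = (v 0)\<^sup>2 + (\<Sum>j | k < j \<and> j < p. (v j)\<^sup>2)"
      by (subst sum.insert) (auto simp: w_def intro!: sum.cong)
    finally show ?thesis .
  qed
  have e0: "0 < e" "e \<le> 1 / 2"
    using assms(1) unfolding assms(2) by (auto simp: divide_simps)
  \<comment> \<open>The second term gives \<open>t * B \<le> e / 2\<close>; the first keeps
    \<open>t\<close> below 1.\<close>
  define t where "t = min (1 / 2) (e / (2 * B))"
  have t: "0 < t" "t < 1" "t * B \<le> e / 2"
    using B(1) e0 by (auto simp: t_def min_def field_simps)
  define X where "X = (1 / (1 - t)) \<cdot>\<^sub>m center p k e + (- t / (1 - t)) \<cdot>\<^sub>m Y"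
  have cc: "center p k e \<in> carrier_mat p p"
    by (simp add: center_def)
  have "0 \<le> qform p X v" for v
  proof -
    let ?S = "(v 0)\<^sup>2 + (\<Sum>j | k < j \<and> j < p. (v j)\<^sup>2)"
    have S: "0 \<le> ?S"
      by (intro add_nonneg_nonneg sum_nonneg) auto
    have "t * qform p Y v \<le> t * (B * ?S)"
      using qY t by (intro mult_left_mono) auto
    also have "\<dots> = (t * B) * ?S"
      by simp
    also have "\<dots> \<le> (e / 2) * ?S"
      using t S by (intro mult_right_mono) auto
    also have "\<dots> \<le> qform p (center p k e) v"
      by (rule qform_center_ge[OF assms(1,2)])
    finally have "0 \<le> (qform p (center p k e) v - t * qform p Y v) / (1 - t)"
      using t by (intro divide_nonneg_nonneg) auto
    also have "\<dots> = qform p X v"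
      unfolding X_def qform_comb[OF cc Y(2)] by (simp add: diff_divide_distrib)
    finally show ?thesis .
  qed
  then have "X \<in> psd_mats p"
    unfolding psd_mats_iff X_def using sym_mats_comb[OF center_sym Y(1)] by auto
  moreover have "center p k e = t \<cdot>\<^sub>m Y + (1 - t) \<cdot>\<^sub>m X"
  proof (rule eq_matI)
    fix i j
    assume "i < dim_row (t \<cdot>\<^sub>m Y + (1 - t) \<cdot>\<^sub>m X)" "j < dim_col (t \<cdot>\<^sub>m Y + (1 - t) \<cdot>\<^sub>m X)"
    then have "i < p" "j < p"
      using Y(2) by (auto simp: X_def)
    moreover have "t * y + (1 - t) * (1 / (1 - t) * c + - t / (1 - t) * y) = c" for c y
      using t by (simp add: right_diff_distrib)
    ultimately show "center p k e $$ (i, j) = (t \<cdot>\<^sub>m Y + (1 - t) \<cdot>\<^sub>m X) $$ (i, j)"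
      using cc Y(2) by (simp add: X_def)
  qed (use cc Y(2) in \<open>auto simp: X_def\<close>)
  ultimately show ?thesis
    using t by blast
qed

text \<open>Any face containing the feasible set contains the center and therefore both ends of
  every segment through it, in particular every \<open>Y\<close> of the coordinate face.\<close>

lemma min_face_moment_affine:
  assumes "k < p"
  shows "min_face p (moment_affine p k \<inter> psd_mats p) = coord_face p k 0"
proof
  have "moment_affine p k \<inter> psd_mats p \<subseteq> coord_face p k 0"
    using moment_affine_psd_coord_face[OF assms, of _ k] by auto
  then show "min_face p (moment_affine p k \<inter> psd_mats p) \<subseteq> coord_face p k 0"
    using coord_face_is_face[OF assms] by (auto simp: min_face_def)
next
  have "Y \<in> F" if Y: "Y \<in> coord_face p k 0" and F: "is_face F (psd_mats p)"
    "moment_affine p k \<inter> psd_mats p \<subseteq> F" for Y F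
  proof -
    define e where "e = 1 / (2 * real p)"
    have "center p k e \<in> F"
      using F(2) center_psd[OF assms e_def] center_affine[OF assms] by auto
    moreover obtain t X where "0 < t" "t < 1" "X \<in> psd_mats p"
      "center p k e = t \<cdot>\<^sub>m Y + (1 - t) \<cdot>\<^sub>m X"
      using center_minus_psd[OF assms e_def Y] by blast
    moreover have "Y \<in> psd_mats p"
      using Y by (simp add: coord_face_def)
    ultimately show ?thesis
      using F(1) unfolding is_face_def by metis
  qed
  then show "coord_face p k 0 \<subseteq> min_face p (moment_affine p k \<inter> psd_mats p)"
    by (auto simp: min_face_def)
qed

section \<open>Length of the reduction sequences\<close>

lemma facial_reduction_seq_length:
  assumes "k < p"
  shows "(\<exists>F W. facial_reduction_seq p (moment_affine p k) d F W) \<longleftrightarrow> d = k"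
proof
  assume "\<exists>F W. facial_reduction_seq p (moment_affine p k) d F W"
  then obtain F W where fr: "facial_reduction_seq p (moment_affine p k) d F W"
    by blast
  \<comment> \<open>The bound \<open>j \<le> k\<close> is carried along because subtraction
    truncates; it persists since a step is possible only for \<open>0 < k - j\<close>.\<close>
  have F: "j \<le> d \<Longrightarrow> j \<le> k \<and> F j = coord_face p k (k - j)" for j
  proof (induction j)
    case 0
    then show ?case
      using fr by (auto simp: facial_reduction_seq_def coord_face_def)
  next
    case (Suc j)
    then have IH: "j \<le> k" "F j = coord_face p k (k - j)"
      by auto
    have "Suc j \<in> {1..d}"
      using Suc.prems by auto
    then have step: "W (Suc j) \<in> perp p (moment_affine p k) \<inter>
          (dual_cone p (F (Suc j - 1)) - perp p (F (Suc j - 1)))"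
        "F (Suc j) = F (Suc j - 1) \<inter> perp p {W (Suc j)}"
      using fr unfolding facial_reduction_seq_def by blast+
    then have W: "W (Suc j) \<in> perp p (moment_affine p k)"
      "W (Suc j) \<in> dual_cone p (coord_face p k (k - j))"
      "W (Suc j) \<notin> perp p (coord_face p k (k - j))"
      and FS: "F (Suc j) = coord_face p k (k - j) \<inter> perp p {W (Suc j)}"
      unfolding diff_Suc_1 IH(2) by blast+
    from facial_step_forced[OF W assms] FS show ?case
      by auto
  qed
  \<comment> \<open>Coordinate faces for different \<open>q \<le> k\<close> differ, so the minimal
    face is reached only after all \<open>k\<close> cuts.\<close>
  have "coord_face p k (k - d) = coord_face p k 0"
    using F[of d] fr min_face_moment_affine[OF assms] by (simp add: facial_reduction_seq_def)
  then have "k - d = 0"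
    using coord_face_neq[of 0 "k - d" k p] assms by (metis diff_le_self neq0_conv)
  with F[of d] show "d = k"
    by auto
next
  assume "d = k"
  \<comment> \<open>Step \<open>j\<close> removes coordinate \<open>k - j + 1\<close>, the middle of
    antidiagonal \<open>2 * (k - j + 1)\<close>.\<close>
  have "facial_reduction_seq p (moment_affine p k) k (\<lambda>j. coord_face p k (k - j))
    (\<lambda>j. antidiag p k (2 * (k - j + 1)))"
    unfolding facial_reduction_seq_def
  proof (intro conjI allI impI ballI)
    show "coord_face p k (k - 0) = psd_mats p"
      by (auto simp: coord_face_def)
    show "coord_face p k (k - k) = min_face p (moment_affine p k \<inter> psd_mats p)"
      using min_face_moment_affine[OF assms] by simp
    show "is_face (coord_face p k (k - j)) (psd_mats p)" for j
      by (rule coord_face_is_face[OF assms])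
  next
    fix j
    assume j: "j \<in> {1..k}"
    define q where "q = k - j + 1"
    have q: "0 < q" "q \<le> k" "k - (j - 1) = q" "k - j = q - 1"
      using j by (auto simp: q_def)
    have W: "antidiag p k (2 * q) \<in> perp p (moment_affine p k)"
      using q by (intro antidiag_perp) auto
    note ex = antidiag_exposes[OF assms q(1,2)]
    show "antidiag p k (2 * (k - j + 1)) \<in> perp p (moment_affine p k) \<inter>
        (dual_cone p (coord_face p k (k - (j - 1))) - perp p (coord_face p k (k - (j - 1))))"
      using W ex unfolding q(3) q_def[symmetric] by blast
    show "coord_face p k (k - j) =
        coord_face p k (k - (j - 1)) \<inter> perp p {antidiag p k (2 * (k - j + 1))}"
      unfolding q(3) q_def[symmetric] unfolding q(4)
      using facial_step_forced(2)[OF W ex assms q(2)] by simp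
  qed
  with \<open>d = k\<close> show "\<exists>F W. facial_reduction_seq p (moment_affine p k) d F W"
    by blast
qed

lemma sing_deg_moment_affine:
  assumes "k < p"
  shows "sing_deg p (moment_affine p k) = k" "max_sing_deg p (moment_affine p k) = k"
  unfolding sing_deg_def max_sing_deg_def facial_reduction_seq_length[OF assms]
  by (auto intro: Least_equality Greatest_equality)

section \<open>The moment configuration\<close>

text \<open>The points are 1 to \<open>N\<close>. Column \<open>a\<close> belongs to index
  \<open>a + 1\<close> of \<open>Z\<close>, which explains the exponent.\<close>

definition moment_mat :: "nat \<Rightarrow> nat \<Rightarrow> nat \<Rightarrow> nat \<Rightarrow> real mat" where
  "moment_mat n r k N = mat n r (\<lambda>(i, a).
     if i < N then (if a < k then real (i + 1) ^ (a + 1) else 0)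
     else (if a = k + (i - N) then 1 else 0))"

text \<open>The missing constant term makes 0 a further root, giving \<open>N + 1\<close> roots for
  a degree at most \<open>m \<le> N\<close>.\<close>

lemma poly_zero_at_naturals:
  fixes c :: "nat \<Rightarrow> real"
  assumes c0: "c 0 = 0" and roots: "\<And>i. i < N \<Longrightarrow> (\<Sum>t\<le>m. c t * real (i + 1) ^ t) = 0"
    and "m \<le> N" "t \<le> m"
  shows "c t = 0"
proof (rule ccontr)
  assume "c t \<noteq> 0"
  then have fin: "finite {z. (\<Sum>t\<le>m. c t * z ^ t) = 0}"
    and card: "card {z. (\<Sum>t\<le>m. c t * z ^ t) = 0} \<le> m"
    using polyfun_rootbound[of c t m] assms(4) by auto
  have "(\<Sum>t\<le>m. c t * real i ^ t) = 0" if "i \<le> N" for i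
  proof (cases i)
    case 0
    then show ?thesis
      using c0 by (auto intro!: sum.neutral simp: power_0_left)
  next
    case (Suc i')
    then show ?thesis
      using roots[of i'] that by simp
  qed
  then have "real ` {..N} \<subseteq> {z. (\<Sum>t\<le>m. c t * z ^ t) = 0}"
    by auto
  from card_mono[OF fin this] card \<open>m \<le> N\<close> show False
    by (simp add: card_image inj_on_def)
qed

text \<open>The first \<open>k\<close> entries of \<open>v\<close> are the coefficients of a
  polynomial without constant term that vanishes at all \<open>N\<close> points; each unit row kills
  one further entry.\<close>

lemma moment_mat_kernel:
  assumes "k \<le> r" "n = N + (r - k)" "k \<le> N" "v \<in> carrier_vec r"
    and Av: "moment_mat n r k N *\<^sub>v v = 0\<^sub>v n"
  shows "v = 0\<^sub>v r"
proof -
  have row: "(\<Sum>a<r. moment_mat n r k N $$ (i, a) * v $ a) = 0" if "i < n" for i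
  proof -
    have "(moment_mat n r k N *\<^sub>v v) $ i = (\<Sum>a<r. moment_mat n r k N $$ (i, a) * v $ a)"
      using that assms(4) by (auto simp: moment_mat_def scalar_prod_def atLeast0LessThan intro!: sum.cong)
    then show ?thesis
      using Av that by simp
  qed
  define c where "c t = (if t = 0 then 0 else v $ (t - 1))" for t
  have "c t = 0" if "t \<le> k" for t
  proof (rule poly_zero_at_naturals[where N = N and m = k])
    fix i assume i: "i < N"
    have "(\<Sum>t\<le>k. c t * real (i + 1) ^ t) = (\<Sum>a<k. v $ a * real (i + 1) ^ (a + 1))"
      unfolding sum.atMost_shift by (simp add: c_def)
    also have "\<dots> = (\<Sum>a<r. moment_mat n r k N $$ (i, a) * v $ a)"
      using assms(1-3) i by (intro sum.mono_neutral_cong_left) (auto simp: moment_mat_def)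
    finally show "(\<Sum>t\<le>k. c t * real (i + 1) ^ t) = 0"
      using row[of i] i assms(2) by simp
  qed (use that assms(3) in \<open>auto simp: c_def\<close>)
  then have low: "v $ a = 0" if "a < k" for a
    using that by (metis Suc_leI c_def diff_Suc_1 nat.distinct(1))
  have high: "v $ a = 0" if "k \<le> a" "a < r" for a
  proof -
    define i where "i = N + (a - k)"
    have i: "i < n" "\<not> i < N" "k + (i - N) = a"
      using that assms(1,2) by (auto simp: i_def)
    have "(\<Sum>b<r. moment_mat n r k N $$ (i, b) * v $ b) = (\<Sum>b<r. if b = a then v $ b else 0)"
      using i by (intro sum.cong) (auto simp: moment_mat_def)
    then show ?thesis
      using row[OF i(1)] that by simp
  qed
  show ?thesis
    using assms(4) low high by (intro eq_vecI) (auto simp: not_less[symmetric])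
qed

lemma full_rank_if_trivial_kernel:
  fixes A :: "real mat"
  assumes A: "A \<in> carrier_mat n r"
    and ker: "\<And>v. v \<in> carrier_vec r \<Longrightarrow> A *\<^sub>v v = 0\<^sub>v n \<Longrightarrow> v = 0\<^sub>v r"
  shows "vec_space.rank n A = r"
proof -
  interpret vec_space "TYPE(real)" n .
  have unit: "A *\<^sub>v unit_vec r i = col A i" if "i < r" for i
    using A that by (intro eq_vecI) (auto simp: scalar_prod_right_unit)
  \<comment> \<open>Linear independence concerns the set of columns and would miss repetitions; two
    equal columns would put a difference of unit vectors into the kernel.\<close>
  have "distinct (cols A)"
    unfolding distinct_conv_nth
  proof (intro allI impI notI)
    fix i j
    assume ij: "i < length (cols A)" "j < length (cols A)" "i \<noteq> j" "cols A ! i = cols A ! j"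
    then have ijr: "i < r" "j < r" "col A i = col A j"
      using A by auto
    have "A *\<^sub>v (unit_vec r i - unit_vec r j) = A *\<^sub>v unit_vec r i - A *\<^sub>v unit_vec r j"
      using A by (intro mult_minus_distrib_mat_vec) auto
    also have "\<dots> = col A i - col A j"
      using ijr by (simp add: unit)
    also have "\<dots> = 0\<^sub>v n"
      using A ijr by auto
    finally have "unit_vec r i - unit_vec r j = (0\<^sub>v r :: real vec)"
      by (intro ker) auto
    then have "(unit_vec r i - unit_vec r j) $ i = (0 :: real)"
      using ijr by simp
    then show False
      using ijr ij(3) by simp
  qed
  moreover have "lin_indpt (set (cols A))"
    using lin_depE[OF A _ calculation] ker by metis
  ultimately show ?thesis
    using lin_indpt_full_rank[OF A] by blast
qed

section \<open>Constraints of the moment configuration\<close>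

lemma Phi_moment_row:
  assumes "k \<le> r" "n = N + (r - k)" "i < N" "a \<le> r" "b \<le> r"
  shows "Phi (row (moment_mat n r k N) i) $$ (a, b) = coef k a b * real (i + 1) ^ (a + b)"
proof -
  have "row (moment_mat n r k N) i $ c = (if c < k then real (i + 1) ^ (c + 1) else 0)" if "c < r" for c
    using assms(2,3) that by (simp add: moment_mat_def)
  then show ?thesis
    using assms by (cases a; cases b) (auto simp: Phi_def coef_def moment_mat_def power_add)
qed

text \<open>Sorting the entries by antidiagonal shows each constraint to be the value at
  \<open>real (i + 1)\<close> of one polynomial that does not depend on \<open>i\<close>.\<close>

lemma mat_inner_Phi_moment_row:
  assumes "k \<le> r" "n = N + (r - k)" "i < N" and Z: "Z \<in> sym_mats (r + 1)"
  shows "mat_inner (Phi (row (moment_mat n r k N) i)) Z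
    = (\<Sum>t\<le>2 * k. mat_inner (antidiag (r + 1) k t) Z * real (i + 1) ^ t)"
proof -
  let ?s = "real (i + 1)"
  have "mat_inner (Phi (row (moment_mat n r k N) i)) Z
    = (\<Sum>a<r + 1. \<Sum>b<r + 1. coef k a b * ?s ^ (a + b) * Z $$ (a, b))"
    using assms Phi_moment_row[OF assms(1-3)]
    by (subst mat_inner_sym[OF _ Z]) (auto simp: Phi_def moment_mat_def intro!: sum.cong)
  also have "\<dots> = (\<Sum>a<r + 1. \<Sum>b<r + 1. \<Sum>t\<le>2 * k.
      antidiag (r + 1) k t $$ (a, b) * Z $$ (a, b) * ?s ^ t)"
  proof (intro sum.cong refl)
    fix a b assume ab: "a \<in> {..<r + 1}" "b \<in> {..<r + 1}"
    have "(\<Sum>t\<le>2 * k. antidiag (r + 1) k t $$ (a, b) * Z $$ (a, b) * ?s ^ t)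
      = (\<Sum>t\<le>2 * k. if t = a + b then coef k a b * ?s ^ (a + b) * Z $$ (a, b) else 0)"
      using ab by (intro sum.cong refl) (auto simp: antidiag_def)
    \<comment> \<open>Where \<open>a + b\<close> exceeds \<open>2 * k\<close>, an index exceeds
      \<open>k\<close> and the weight is zero.\<close>
    also have "\<dots> = coef k a b * ?s ^ (a + b) * Z $$ (a, b)"
      by (auto simp: coef_def)
    finally show "coef k a b * ?s ^ (a + b) * Z $$ (a, b)
      = (\<Sum>t\<le>2 * k. antidiag (r + 1) k t $$ (a, b) * Z $$ (a, b) * ?s ^ t)" ..
  qed
  also have "\<dots> = (\<Sum>a<r + 1. \<Sum>t\<le>2 * k. \<Sum>b<r + 1.
      antidiag (r + 1) k t $$ (a, b) * Z $$ (a, b) * ?s ^ t)"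
    by (intro sum.cong refl sum.swap)
  also have "\<dots> = (\<Sum>t\<le>2 * k. \<Sum>a<r + 1. \<Sum>b<r + 1.
      antidiag (r + 1) k t $$ (a, b) * Z $$ (a, b) * ?s ^ t)"
    by (rule sum.swap)
  also have "\<dots> = (\<Sum>t\<le>2 * k. mat_inner (antidiag (r + 1) k t) Z * ?s ^ t)"
    by (simp only: mat_inner_sym[OF antidiag_carrier Z] sum_distrib_right)
  finally show ?thesis .
qed

lemma mat_inner_Phi_unit_row:
  assumes "k \<le> r" "n = N + (r - k)" "N \<le> i" "i < n" and Z: "Z \<in> sym_mats (r + 1)"
  defines "j \<equiv> k + (i - N) + 1"
  shows "mat_inner (Phi (row (moment_mat n r k N) i)) Z = Z $$ (j, j) - Z $$ (0, j)"
proof -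
  have j: "0 < j" "j < r + 1"
    using assms(1-4) by (auto simp: j_def)
  have zero: "0 < r + 1"
    by simp
  define h where "h = row (moment_mat n r k N) i"
  have h: "dim_vec h = r" "\<And>c. c < r \<Longrightarrow> h $ c = (if c + 1 = j then 1 else 0)"
    using assms(2-4) by (auto simp: h_def moment_mat_def j_def)
  have "mat_inner (Phi h) Z = (\<Sum>a<r + 1. \<Sum>b<r + 1. Phi h $$ (a, b) * Z $$ (a, b))"
    by (rule mat_inner_sym[OF _ Z]) (simp add: Phi_def h(1))
  also have "\<dots> = (\<Sum>a<r + 1. \<Sum>b<r + 1. Z $$ (a, b) * (if a = j \<and> b = j then 1 else 0))
    + (\<Sum>a<r + 1. \<Sum>b<r + 1. (- 1 / 2 * Z $$ (a, b)) * (if a = 0 \<and> b = j then 1 else 0))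
    + (\<Sum>a<r + 1. \<Sum>b<r + 1. (- 1 / 2 * Z $$ (a, b)) * (if a = j \<and> b = 0 then 1 else 0))"
    unfolding sum.distrib[symmetric]
  proof (intro sum.cong refl)
    fix a b assume "a \<in> {..<r + 1}" "b \<in> {..<r + 1}"
    then show "Phi h $$ (a, b) * Z $$ (a, b)
      = Z $$ (a, b) * (if a = j \<and> b = j then 1 else 0)
      + (- 1 / 2 * Z $$ (a, b)) * (if a = 0 \<and> b = j then 1 else 0)
      + (- 1 / 2 * Z $$ (a, b)) * (if a = j \<and> b = 0 then 1 else 0)"
      using j h by (cases a; cases b) (auto simp: Phi_def)
  qed
  also have "\<dots> = Z $$ (j, j) - 1 / 2 * Z $$ (0, j) - 1 / 2 * Z $$ (j, 0)"
    unfolding sum_delta_pair[OF j(2) j(2)] sum_delta_pair[OF zero j(2)] sum_delta_pair[OF j(2) zero]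
    by simp
  finally show ?thesis
    using sym_matsD(2)[OF Z, of 0 j] j by (simp add: h_def)
qed

text \<open>The constraint polynomial has degree at most \<open>2 * k\<close> and no constant term,
  so \<open>2 * k\<close> points suffice to make all its coefficients vanish.\<close>

lemma T_affine_moment_mat:
  assumes "k \<le> r" "n = N + (r - k)" "2 * k \<le> N"
  shows "T_affine (moment_mat n r k N) = moment_affine (r + 1) k"
proof -
  have dim: "dim_row (moment_mat n r k N) = n" "dim_col (moment_mat n r k N) = r"
    by (auto simp: moment_mat_def)
  have "(\<forall>i<n. mat_inner (Phi (row (moment_mat n r k N) i)) Z = 0) \<longleftrightarrow>
     (\<forall>t\<le>2 * k. mat_inner (antidiag (r + 1) k t) Z = 0) \<and>
     (\<forall>j. k < j \<and> j < r + 1 \<longrightarrow> Z $$ (j, j) = Z $$ (0, j))"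
    (is "?L \<longleftrightarrow> ?A \<and> ?B") if Z: "Z \<in> sym_mats (r + 1)" for Z
  proof (intro iffI conjI allI impI)
    fix t assume ?L and t: "t \<le> 2 * k"
    show "mat_inner (antidiag (r + 1) k t) Z = 0"
    proof (rule poly_zero_at_naturals[where N = N and m = "2 * k"])
      show "mat_inner (antidiag (r + 1) k 0) Z = 0"
        by (subst mat_inner_sym[OF _ Z]) (auto simp: antidiag_def coef_def intro!: sum.neutral)
      show "(\<Sum>t\<le>2 * k. mat_inner (antidiag (r + 1) k t) Z * real (i + 1) ^ t) = 0" if "i < N" for i
        using mat_inner_Phi_moment_row[OF assms(1,2) that Z] \<open>?L\<close> that assms(2) by simp
    qed (use t assms in auto)
  next
    fix j assume ?L and j: "k < j \<and> j < r + 1"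
    then have i: "N \<le> N + (j - k - 1)" "N + (j - k - 1) < n"
      using assms(1,2) by auto
    show "Z $$ (j, j) = Z $$ (0, j)"
      using mat_inner_Phi_unit_row[OF assms(1,2) i Z] \<open>?L\<close> i j by simp
  next
    fix i assume "?A \<and> ?B" "i < n"
    then show "mat_inner (Phi (row (moment_mat n r k N) i)) Z = 0"
    proof (cases "i < N")
      case True
      then show ?thesis
        using mat_inner_Phi_moment_row[OF assms(1,2) _ Z] \<open>?A \<and> ?B\<close> by simp
    next
      case False
      then have "k < k + (i - N) + 1 \<and> k + (i - N) + 1 < r + 1"
        using \<open>i < n\<close> assms(1,2) by auto
      then have "Z $$ (k + (i - N) + 1, k + (i - N) + 1) = Z $$ (0, k + (i - N) + 1)"
        using \<open>?A \<and> ?B\<close> by blast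
      then show ?thesis
        using mat_inner_Phi_unit_row[OF assms(1,2) _ \<open>i < n\<close> Z] False by simp
    qed
  qed
  then show ?thesis
    unfolding T_affine_def moment_affine_def dim by auto
qed

theorem corollary5p2:
  fixes n r :: nat
  assumes "n \<ge> 1" and "r \<le> n"
  shows "\<exists>C :: real mat. C \<in> carrier_mat n r \<and> vec_space.rank n C = r \<and>
           sd_T C = min (n - r) r \<and> MSD_T C = min (n - r) r"
proof -
  define k where "k = min (n - r) r"
  \<comment> \<open>The rows left after \<open>r - k\<close> unit rows; \<open>2 * k \<le> N\<close>
    amounts to \<open>k \<le> n - r\<close>, while \<open>k \<le> r\<close> bounds the block by the
    columns. Hence the minimum.\<close>
  define N where "N = n - (r - k)"
  have kN: "k \<le> r" "n = N + (r - k)" "2 * k \<le> N"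
    using assms by (auto simp: k_def N_def)
  let ?C = "moment_mat n r k N"
  have C: "?C \<in> carrier_mat n r"
    by (simp add: moment_mat_def)
  have "vec_space.rank n ?C = r"
    using moment_mat_kernel[OF kN(1,2)] kN(3) by (intro full_rank_if_trivial_kernel[OF C]) auto
  moreover have "sd_T ?C = k" "MSD_T ?C = k"
    using C sing_deg_moment_affine[of k "r + 1"] kN(1)
    by (auto simp: sd_T_def MSD_T_def T_affine_moment_mat[OF kN])
  ultimately show ?thesis
    using C unfolding k_def[symmetric] by blast
qed

end
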